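(* There is an absolute constant $c\ge 10^{-6}$ such that the following holds. Let $P$ be a $2\times k$ zero-one matrix without any homogeneous column (i.e., every column of $P$ contains one 0-entry and one 1-entry). Then every $P$-free $n\times n$ zero-one matrix contains a homogeneous $c\frac{n}{k}\times c\frac{n}{k}$ submatrix.
   Context: A matrix (or column) is homogeneous if all its entries are equal. A $k\times \ell$ matrix $P$ is contained in $A$ if there are rows $i_1<\dots<i_k$ and columns $j_1<\dots<j_\ell$ of $A$ with $A(i_a,j_b)=P(a,b)$ for all $a,b$; $A$ is $P$-free if it does not contain $P$. An $s\times t$ submatrix of $A$ is the restriction of $A$ to some $s$ rows and $t$ columns. Floors and ceilings are omitted. *)

theory Defs
  imports Complex_Main "Jordan_Normal_Form.Matrix" "Jordan_Normal_Form.DL_Submatrix"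
begin

definition zero_one_mat :: "nat mat \<Rightarrow> bool" where
  "zero_one_mat A \<longleftrightarrow> elements_mat A \<subseteq> {0, 1}"

definition homogeneous_mat :: "'a mat \<Rightarrow> bool" where
  "homogeneous_mat A \<longleftrightarrow> (\<forall>x\<in>elements_mat A. \<forall>y\<in>elements_mat A. x = y)"

definition homogeneous_vec :: "'a vec \<Rightarrow> bool" where
  "homogeneous_vec v \<longleftrightarrow> (\<forall>i<dim_vec v. \<forall>j<dim_vec v. v $ i = v $ j)"

(* Containment is order-sensitive: r and s list the chosen rows and columns in increasing order. *)
definition contains_mat :: "'a mat \<Rightarrow> 'a mat \<Rightarrow> bool" where
  "contains_mat A P \<longleftrightarrow>
     (\<exists>r s. strict_mono_on {..<dim_row P} r \<and> strict_mono_on {..<dim_col P} s \<and>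
            (\<forall>a<dim_row P. r a < dim_row A) \<and> (\<forall>b<dim_col P. s b < dim_col A) \<and>
            (\<forall>a<dim_row P. \<forall>b<dim_col P. A $$ (r a, s b) = P $$ (a, b)))"

abbreviation free_of_mat :: "'a mat \<Rightarrow> 'a mat \<Rightarrow> bool" where
  "free_of_mat P A \<equiv> \<not> contains_mat A P"

definition has_homogeneous_submatrix :: "'a mat \<Rightarrow> nat \<Rightarrow> nat \<Rightarrow> bool" where
  "has_homogeneous_submatrix A s t \<longleftrightarrow>
     (\<exists>I J. I \<subseteq> {..<dim_row A} \<and> J \<subseteq> {..<dim_col A} \<and> card I = s \<and> card J = t \<and>
            homogeneous_mat (submatrix A I J))"

end

theory Submission
  imports Defs "HOL-Library.Infinite_Set"
begin

text \<open>
  Cut the columns into \<open>8 * k\<close> intervals. Since no column of \<open>P\<close> is homogeneous, two rows that are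
  inclusion-incomparable (as sets of 1-entries) on \<open>k\<close> of the intervals would contain \<open>P\<close>, one column
  per interval. Hence by averaging there is an interval on which at most an eighth of all pairs of
  rows are incomparable. Half of the rows have, say, at most half of the interval filled with
  1-entries; among these most pairs are comparable, so one of them lies above a constant
  proportion of all rows, and these rows all vanish where it vanishes.
\<close>

section \<open>Almost total relations and families of sets that are almost chains\<close>

text \<open>Double counting: if every element had fewer than a quarter of \<open>S\<close> below it,
  then \<open>Q\<close> and its converse together would cover fewer than half of all ordered pairs,
  while the incomparable pairs make up at most the other half.\<close>

lemma exists_many_below:
  fixes Q :: "'a \<Rightarrow> 'a \<Rightarrow> bool"
  assumes "finite S" "S \<noteq> {}"
    and inc: "2 * card {(i, j) \<in> S \<times> S. \<not> Q i j \<and> \<not> Q j i} \<le> card S * card S"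
  shows "\<exists>i\<in>S. card S \<le> 4 * card {j \<in> S. Q j i}"
proof (rule ccontr)
  assume "\<not> ?thesis"
  then have less: "4 * card {j \<in> S. Q j i} < card S" if "i \<in> S" for i
    using that by force
  define D where "D = (SIGMA i:S. {j \<in> S. Q j i})"
  have "finite D"
    using \<open>finite S\<close> by (simp add: D_def)
  have "4 * card D = (\<Sum>i\<in>S. 4 * card {j \<in> S. Q j i})"
    using \<open>finite S\<close> by (simp add: D_def sum_distrib_left)
  also have "\<dots> < (\<Sum>i\<in>S. card S)"
    using assms less by (intro sum_strict_mono) auto
  finally have D: "4 * card D < card S * card S"
    by simp
  \<comment> \<open>\<open>D\<close> holds the comparable pairs with the larger element first; its
    image under \<open>prod.swap\<close> covers the other orientation.\<close>
  have "S \<times> S \<subseteq> {(i, j) \<in> S \<times> S. \<not> Q i j \<and> \<not> Q j i} \<union> (D \<union> prod.swap ` D)"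
    by (force simp: D_def image_iff)
  moreover have "finite {(i, j) \<in> S \<times> S. \<not> Q i j \<and> \<not> Q j i}"
    by (rule finite_subset[of _ "S \<times> S"]) (use \<open>finite S\<close> in auto)
  ultimately have "card (S \<times> S) \<le> card ({(i, j) \<in> S \<times> S. \<not> Q i j \<and> \<not> Q j i} \<union> (D \<union> prod.swap ` D))"
    using \<open>finite D\<close> by (intro card_mono) auto
  also have "\<dots> \<le> card {(i, j) \<in> S \<times> S. \<not> Q i j \<and> \<not> Q j i} + (card D + card (prod.swap ` D))"
    by (meson card_Un_le add_left_mono order_trans)
  also have "card (prod.swap ` D) = card D"
    by (simp add: card_image)
  finally show False
    using D inc by (simp add: card_cartesian_product)
qed

text \<open>The factor 8 is 2 times 4: half of the rows are sparse on \<open>W\<close> (or half are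
  dense), and \<open>exists_many_below\<close> keeps a quarter of those. Sparse rows lead to an
  empty rectangle, dense rows to a full one.\<close>

lemma almost_chain_rectangle:
  fixes R :: "'a \<Rightarrow> 'b set"
  assumes "finite I" "finite W" "I \<noteq> {}"
    and inc: "8 * card {(i, j) \<in> I \<times> I. \<not> R i \<inter> W \<subseteq> R j \<and> \<not> R j \<inter> W \<subseteq> R i} \<le> card I * card I"
  obtains T U where "T \<subseteq> I" "U \<subseteq> W" "card I \<le> 8 * card T" "card W \<le> 2 * card U"
    "(\<forall>i\<in>T. U \<subseteq> R i) \<or> (\<forall>i\<in>T. U \<inter> R i = {})"
proof -
  let ?N = "{(i, j) \<in> I \<times> I. \<not> R i \<inter> W \<subseteq> R j \<and> \<not> R j \<inter> W \<subseteq> R i}"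
  define S where "S = {i \<in> I. card W \<le> 2 * card (W - R i)}"
  define S' where "S' = {i \<in> I. card W \<le> 2 * card (W \<inter> R i)}"
  have fin: "finite ?N"
    by (rule finite_subset[of _ "I \<times> I"]) (use \<open>finite I\<close> in auto)
  have "card W = card (W \<inter> R i) + card (W - R i)" for i
    using \<open>finite W\<close> by (metis card_Int_Diff)
  then have "I \<subseteq> S \<union> S'"
    unfolding S_def S'_def
    by (smt (verit) UnCI mem_Collect_eq mult_2 nat_le_linear add_le_mono subsetI le_trans)
  moreover have sub: "S \<subseteq> I" "S' \<subseteq> I"
    by (auto simp: S_def S'_def)
  ultimately have "card I \<le> card S + card S'"
    by (metis card_Un_le card_mono finite_Un finite_subset le_trans \<open>finite I\<close>)
  then consider "card I \<le> 2 * card S" | "card I \<le> 2 * card S'"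
    by linarith
  then show ?thesis
  proof cases
    case 1
    \<comment> \<open>Passing from \<open>I\<close> to \<open>S\<close> raises the proportion of
      incomparable pairs at most fourfold, from an eighth to the half that
      \<open>exists_many_below\<close> tolerates.\<close>
    have "card I * card I \<le> (2 * card S) * (2 * card S)"
      using 1 by (intro mult_mono) auto
    moreover have "card {(i, j) \<in> S \<times> S. \<not> R i \<inter> W \<subseteq> R j \<and> \<not> R j \<inter> W \<subseteq> R i} \<le> card ?N"
      using sub fin by (intro card_mono) auto
    moreover have "S \<noteq> {}" "finite S"
      using 1 assms sub by (auto intro: finite_subset)
    ultimately obtain i where i: "i \<in> S" "card S \<le> 4 * card {j \<in> S. R j \<inter> W \<subseteq> R i}"
      using exists_many_below[of S "\<lambda>i j. R i \<inter> W \<subseteq> R j"] inc by auto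
    \<comment> \<open>Whatever lies below row \<open>i\<close> within \<open>W\<close> avoids
      \<open>W - R i\<close>, which is at least half of \<open>W\<close> since \<open>i\<close> is
      in \<open>S\<close>.\<close>
    show ?thesis
      by (rule that[of "{j \<in> S. R j \<inter> W \<subseteq> R i}" "W - R i"]) (use 1 i in \<open>auto simp: S_def\<close>)
  next
    case 2
    have "card I * card I \<le> (2 * card S') * (2 * card S')"
      using 2 by (intro mult_mono) auto
    moreover have "card {(i, j) \<in> S' \<times> S'. \<not> R j \<inter> W \<subseteq> R i \<and> \<not> R i \<inter> W \<subseteq> R j} \<le> card ?N"
      using sub fin by (intro card_mono) auto
    moreover have "S' \<noteq> {}" "finite S'"
      using 2 assms sub by (auto intro: finite_subset)
    ultimately obtain i where i: "i \<in> S'" "card S' \<le> 4 * card {j \<in> S'. R i \<inter> W \<subseteq> R j}"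
      using exists_many_below[of S' "\<lambda>i j. R j \<inter> W \<subseteq> R i"] inc by auto
    \<comment> \<open>The dual situation, with inclusion reversed: every row above \<open>i\<close>
      contains \<open>W \<inter> R i\<close>.\<close>
    show ?thesis
      by (rule that[of "{j \<in> S'. R i \<inter> W \<subseteq> R j}" "W \<inter> R i"]) (use 2 i in \<open>auto simp: S'_def\<close>)
  qed
qed

text \<open>\<open>has_homogeneous_submatrix\<close> asks for exact sizes, so a larger constant
  rectangle is trimmed; entries of the submatrix are then located through
  \<open>pick\<close>.\<close>

lemma has_homogeneous_submatrixI:
  assumes "I \<subseteq> {..<dim_row A}" "J \<subseteq> {..<dim_col A}" "s \<le> card I" "t \<le> card J"
    and const: "\<And>i j. i \<in> I \<Longrightarrow> j \<in> J \<Longrightarrow> A $$ (i, j) = v"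
  shows "has_homogeneous_submatrix A s t"
proof -
  obtain I' J' where I': "I' \<subseteq> I" "card I' = s" and J': "J' \<subseteq> J" "card J' = t"
    using assms by (metis obtain_subset_with_card_n)
  have eq: "{i. i < dim_row A \<and> i \<in> I'} = I'" "{i. i < dim_col A \<and> i \<in> J'} = J'"
    using assms I' J' by auto
  have "submatrix A I' J' $$ (i, j) = v"
    if "i < dim_row (submatrix A I' J')" "j < dim_col (submatrix A I' J')" for i j
  proof -
    have "i < card I'" "j < card J'"
      using that by (auto simp: dim_submatrix eq)
    then have "pick I' i \<in> I'" "pick J' j \<in> J'"
      by (simp_all add: pick_in_set_le)
    then show ?thesis
      using const I' J' \<open>i < card I'\<close> \<open>j < card J'\<close> by (auto simp: submatrix_def eq)
  qed
  then have "homogeneous_mat (submatrix A I' J')"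
    unfolding homogeneous_mat_def by (metis elements_matD)
  then show ?thesis
    unfolding has_homogeneous_submatrix_def using I' J' assms by blast
qed

lemma zero_one_mat_entry:
  assumes "zero_one_mat A" "i < dim_row A" "j < dim_col A"
  shows "A $$ (i, j) = 0 \<or> A $$ (i, j) = 1"
  using assms elements_matI[of A "dim_row A" "dim_col A" i j] by (auto simp: zero_one_mat_def)

section \<open>Incomparable rows and copies of \<open>P\<close>\<close>

definition ones :: "nat mat \<Rightarrow> nat \<Rightarrow> nat set" where
  "ones A i = {c. A $$ (i, c) = 1}"

definition block :: "nat \<Rightarrow> nat \<Rightarrow> nat set" where
  "block w b = {b * w..<Suc b * w}"

definition incomparable_on :: "nat mat \<Rightarrow> nat set \<Rightarrow> nat \<Rightarrow> nat \<Rightarrow> bool" where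
  "incomparable_on A W i j \<longleftrightarrow> \<not> ones A i \<inter> W \<subseteq> ones A j \<and> \<not> ones A j \<inter> W \<subseteq> ones A i"

lemma incomparable_on_sym: "incomparable_on A W i j \<longleftrightarrow> incomparable_on A W j i"
  by (auto simp: incomparable_on_def)

lemma block_less:
  assumes "x \<in> block w a" "y \<in> block w b" "a < b"
  shows "x < y"
proof -
  have "Suc a * w \<le> b * w"
    using \<open>a < b\<close> by (intro mult_le_mono1) simp
  then show ?thesis
    using assms by (auto simp: block_def)
qed

text \<open>Incomparability on a block supplies both a column reading 1 over 0 and one reading 0
  over 1 in rows \<open>i\<close> and \<open>j\<close>. These are the only possible columns of
  \<open>P\<close>, so each can be matched in a block of its own.\<close>

lemma contains_mat_if_incomparable:
  fixes A P :: "nat mat"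
  assumes P: "P \<in> carrier_mat 2 k" "zero_one_mat P" "\<forall>j<k. \<not> homogeneous_vec (col P j)"
    and A: "A \<in> carrier_mat m n" "zero_one_mat A"
    and ij: "i < j" "j < m"
    and B: "finite B" "k \<le> card B" "\<And>b. b \<in> B \<Longrightarrow> block w b \<subseteq> {..<n}"
      "\<And>b. b \<in> B \<Longrightarrow> incomparable_on A (block w b) i j"
  shows "contains_mat A P"
proof -
  let ?r = "\<lambda>a::nat. if a = 0 then i else j"
  have mem: "enumerate B a \<in> B" if "a < k" for a
    using finite_enumerate_in_set[of B a] B that by simp
  have "\<exists>c. c \<in> block w (enumerate B a) \<and> A $$ (i, c) = P $$ (0, a) \<and> A $$ (j, c) = P $$ (1, a)"
    if "a < k" for a
  proof -
    note in_B = mem[OF that]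
    have "P $$ (0, a) \<noteq> P $$ (1, a)"
      using P that by (force simp: homogeneous_vec_def less_2_cases_iff)
    then have P_cases: "P $$ (0, a) = 0 \<and> P $$ (1, a) = 1 \<or> P $$ (0, a) = 1 \<and> P $$ (1, a) = 0"
      using zero_one_mat_entry[of P 0 a] zero_one_mat_entry[of P 1 a] P that by auto
    obtain x y where xy: "x \<in> block w (enumerate B a)" "y \<in> block w (enumerate B a)"
      "A $$ (i, x) = 1" "A $$ (j, x) \<noteq> 1" "A $$ (j, y) = 1" "A $$ (i, y) \<noteq> 1"
      using B(4)[OF in_B] by (auto simp: incomparable_on_def ones_def)
    moreover have "x < n" "y < n"
      using xy B(3)[OF in_B] by auto
    ultimately have "A $$ (j, x) = 0" "A $$ (i, y) = 0"
      using zero_one_mat_entry[of A j x] zero_one_mat_entry[of A i y] A ij by auto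
    then show ?thesis
      using P_cases xy by auto
  qed
  then obtain s where s: "\<And>a. a < k \<Longrightarrow> s a \<in> block w (enumerate B a) \<and>
      A $$ (i, s a) = P $$ (0, a) \<and> A $$ (j, s a) = P $$ (1, a)"
    by metis
  \<comment> \<open>\<open>enumerate\<close> lists the blocks of \<open>B\<close> from left to
    right, so the chosen columns inherit their order.\<close>
  have "strict_mono_on {..<k} s"
  proof (rule strict_mono_onI)
    fix a b assume ab: "a \<in> {..<k}" "b \<in> {..<k}" "a < b"
    then have "enumerate B a < enumerate B b"
      using B by (intro finite_enumerate_mono) auto
    then show "s a < s b"
      using block_less s ab by (meson lessThan_iff)
  qed
  moreover have "strict_mono_on {..<2} ?r"
    using ij by (auto simp: strict_mono_on_def)
  moreover have "s b < n" if "b < k" for b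
    using s[OF that] B(3)[OF mem[OF that]] by auto
  ultimately show ?thesis
    unfolding contains_mat_def using P A ij s
    by (intro exI[of _ ?r] exI[of _ s]) (auto simp: less_2_cases_iff)
qed

lemma free_of_mat_incomparable_blocks:
  fixes A P :: "nat mat"
  assumes P: "P \<in> carrier_mat 2 k" "zero_one_mat P" "\<forall>j<k. \<not> homogeneous_vec (col P j)"
    and A: "A \<in> carrier_mat m n" "zero_one_mat A" "free_of_mat P A"
    and ij: "i < m" "j < m" and w: "M * w \<le> n"
  shows "card {b \<in> {..<M}. incomparable_on A (block w b) i j} \<le> k"
proof (cases "i = j")
  case True
  then show ?thesis
    by (simp add: incomparable_on_def)
next
  case False
  have sub: "block w b \<subseteq> {..<n}" if "b < M" for b
  proof -
    have "Suc b * w \<le> M * w"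
      using that by (intro mult_le_mono1) simp
    then show ?thesis
      using w by (auto simp: block_def)
  qed
  \<comment> \<open>Containment respects the order of rows, so the case \<open>i < j\<close> comes
    first; symmetry of incomparability settles the other.\<close>
  have less: "card {b \<in> {..<M}. incomparable_on A (block w b) i j} \<le> k" if "i < j" "j < m" for i j
  proof (rule ccontr)
    assume "\<not> ?thesis"
    then have "contains_mat A P"
      using sub
      by (intro contains_mat_if_incomparable[OF P A(1,2) that,
            where B = "{b \<in> {..<M}. incomparable_on A (block w b) i j}"]) auto
    then show False
      using A by simp
  qed
  show ?thesis
    using less[of i j] less[of j i] False ij incomparable_on_sym[of A _ i j] by (cases "i < j") auto
qed

section \<open>Averaging over the blocks\<close>

text \<open>Each ordered pair of rows is incomparable on at most \<open>k\<close> of the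
  \<open>8 * k\<close> blocks, so an average block has at most \<open>m * m / 8\<close> incomparable
  pairs.\<close>

lemma exists_almost_chain_block:
  fixes A P :: "nat mat"
  assumes P: "P \<in> carrier_mat 2 k" "zero_one_mat P" "\<forall>j<k. \<not> homogeneous_vec (col P j)"
    and A: "A \<in> carrier_mat m n" "zero_one_mat A" "free_of_mat P A"
    and k: "k \<ge> 1" and w: "8 * k * w \<le> n"
  shows "\<exists>b<8 * k. 8 * card {(i, j) \<in> {..<m} \<times> {..<m}. incomparable_on A (block w b) i j} \<le> m * m"
proof (rule ccontr)
  let ?N = "\<lambda>b. {(i, j) \<in> {..<m} \<times> {..<m}. incomparable_on A (block w b) i j}"
  assume "\<not> ?thesis"
  then have "(\<Sum>b<8 * k. m * m) < (\<Sum>b<8 * k. 8 * card (?N b))"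
    using k by (intro sum_strict_mono) (auto simp: not_le lessThan_empty_iff)
  also have "\<dots> = 8 * (\<Sum>b<8 * k.
      \<Sum>p\<in>{p \<in> {..<m} \<times> {..<m}. case p of (i, j) \<Rightarrow> incomparable_on A (block w b) i j}. 1)"
    by (simp add: sum_distrib_left split_def mem_Times_iff conj_assoc)
  \<comment> \<open>The count of (block, pair) incidences is now taken pair by pair.\<close>
  also have "\<dots> = 8 * (\<Sum>p\<in>{..<m} \<times> {..<m}.
      \<Sum>b\<in>{b \<in> {..<8 * k}. case p of (i, j) \<Rightarrow> incomparable_on A (block w b) i j}. 1)"
    by (subst sum.swap_restrict) simp_all
  also have "\<dots> \<le> 8 * (\<Sum>p\<in>{..<m} \<times> {..<m}. k)"
    using free_of_mat_incomparable_blocks[OF P A _ _ w] by (intro mult_left_mono sum_mono) auto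
  finally show False
    by (simp add: card_cartesian_product)
qed

lemma free_of_mat_homogeneous_submatrix:
  fixes A P :: "nat mat"
  assumes P: "P \<in> carrier_mat 2 k" "zero_one_mat P" "\<forall>j<k. \<not> homogeneous_vec (col P j)"
    and A: "A \<in> carrier_mat m n" "zero_one_mat A" "free_of_mat P A"
    and k: "k \<ge> 1" and w: "8 * k * w \<le> n" and s: "m > 0" "8 * s \<le> m" and t: "2 * t \<le> w"
  shows "has_homogeneous_submatrix A s t"
proof -
  obtain b where b: "b < 8 * k"
    "8 * card {(i, j) \<in> {..<m} \<times> {..<m}. incomparable_on A (block w b) i j} \<le> m * m"
    using exists_almost_chain_block[OF P A k w] by blast
  then obtain T U where TU: "T \<subseteq> {..<m}" "U \<subseteq> block w b" "m \<le> 8 * card T" "w \<le> 2 * card U"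
    "(\<forall>i\<in>T. U \<subseteq> ones A i) \<or> (\<forall>i\<in>T. U \<inter> ones A i = {})"
    using almost_chain_rectangle[of "{..<m}" "block w b" "ones A"] \<open>m > 0\<close>
    by (auto simp: incomparable_on_def block_def)
  have "Suc b * w \<le> 8 * k * w"
    using b by (intro mult_le_mono1) simp
  then have U: "U \<subseteq> {..<n}"
    using TU w by (auto simp: block_def)
  from TU(5) have "(\<forall>i\<in>T. \<forall>j\<in>U. A $$ (i, j) = 1) \<or> (\<forall>i\<in>T. \<forall>j\<in>U. A $$ (i, j) = 0)"
  proof
    \<comment> \<open>Absence from \<open>ones\<close> only says that an entry is not 1; it is 0
      because \<open>T\<close> and \<open>U\<close> lie within the dimensions of
      \<open>A\<close>.\<close>
    assume "\<forall>i\<in>T. U \<inter> ones A i = {}"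
    then have "A $$ (i, j) \<noteq> 1" if "i \<in> T" "j \<in> U" for i j
      using that by (auto simp: ones_def)
    then show ?thesis
      using zero_one_mat_entry[OF A(2)] A(1) TU(1) U
      by (metis carrier_matD lessThan_iff subsetD)
  qed (auto simp: ones_def)
  then obtain v where "\<And>i j. i \<in> T \<Longrightarrow> j \<in> U \<Longrightarrow> A $$ (i, j) = v"
    by blast
  then show ?thesis
    using A TU U s t by (intro has_homogeneous_submatrixI[of T A U s t v]) auto
qed

theorem theorem2p1:
  shows "\<exists>c::real. c \<ge> 1 / 10 ^ 6 \<and>
    (\<forall>(k::nat) (P::nat mat). k \<ge> 1 \<longrightarrow> P \<in> carrier_mat 2 k \<longrightarrow> zero_one_mat P \<longrightarrow>
       (\<forall>j<k. \<not> homogeneous_vec (col P j)) \<longrightarrow>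
       (\<forall>(n::nat) (A::nat mat). A \<in> carrier_mat n n \<longrightarrow> zero_one_mat A \<longrightarrow> free_of_mat P A \<longrightarrow>
          has_homogeneous_submatrix A (nat \<lceil>c * real n / real k\<rceil>) (nat \<lceil>c * real n / real k\<rceil>)))"
\<comment> \<open>The smallest admissible constant is taken; the estimate below would hold up to
  1/32.\<close>
proof (intro exI[of _ "1 / 10 ^ 6"] conjI allI impI)
  fix k n :: nat and P A :: "nat mat"
  assume k: "k \<ge> 1"
    and P: "P \<in> carrier_mat 2 k" "zero_one_mat P" "\<forall>j<k. \<not> homogeneous_vec (col P j)"
    and A: "A \<in> carrier_mat n n" "zero_one_mat A" "free_of_mat P A"
  define x where "x = 1 / 10 ^ 6 * real n / real k"
  define s where "s = nat \<lceil>x\<rceil>"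
  have "x \<ge> 0"
    by (simp add: x_def)
  have "has_homogeneous_submatrix A s s"
  proof (cases "x \<le> 1")
    case True
    show ?thesis
    proof (cases "n = 0")
      case True
      then have "s = 0"
        by (simp add: s_def x_def)
      then show ?thesis
        by (intro has_homogeneous_submatrixI[of "{}" A "{}"]) auto
    next
      case False
      \<comment> \<open>For \<open>x \<le> 1\<close> a single entry is large enough.\<close>
      have "s \<le> 1"
        using True by (simp add: s_def ceiling_le_iff)
      then show ?thesis
        using False A by (intro has_homogeneous_submatrixI[of "{0}" A "{0}"]) auto
    qed
  next
    case False
    \<comment> \<open>Since \<open>x > 1\<close>, rounding up costs at most a factor 2.\<close>
    have "real s \<le> x + 1"
      using \<open>x \<ge> 0\<close> by (simp add: s_def of_nat_nat)
    then have "real s \<le> 2 * x"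
      using False by simp
    then have "real s * real k \<le> 2 * x * real k"
      by (intro mult_right_mono) auto
    also have "2 * x * real k = 2 / 10 ^ 6 * real n"
      using k by (simp add: x_def)
    finally have "16 * (real s * real k) \<le> real n"
      by simp
    then have sk: "16 * (s * k) \<le> n"
      by (metis of_nat_le_iff of_nat_mult of_nat_numeral)
    have "s * 1 \<le> s * k"
      using k by (intro mult_le_mono2)
    then have "8 * s \<le> n"
      using sk by linarith
    moreover have "n > 0"
      using False by (intro gr0I) (simp add: x_def)
    \<comment> \<open>Block width \<open>2 * s\<close> leaves \<open>s\<close> columns after
      halving, and \<open>8 * k\<close> such blocks fit since
      \<open>16 * (s * k) \<le> n\<close>.\<close>
    ultimately show ?thesis
      using sk by (intro free_of_mat_homogeneous_submatrix[OF P A k, where w = "2 * s"])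
        (auto simp: algebra_simps)
  qed
  then show "has_homogeneous_submatrix A (nat \<lceil>1 / 10 ^ 6 * real n / real k\<rceil>) (nat \<lceil>1 / 10 ^ 6 * real n / real k\<rceil>)"
    by (simp only: s_def x_def)
qed simp

end
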